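(* Let $\{(x^k,y^k,s^k,\mu^k)\}\subset\mathbb{R}^n\times\mathbb{R}^m\times\mathbb{R}^m\times\mathbb{R}$ with $\mu^k>0$ and $\mu^k\to 0$ be such that: 1. $x^k\to x^*$ with $a(x^* )\le 0$, and $s^k\to -a(x^* )$; 2. $y^k\ge 0$ and $s^k\ge 0$; 3. for some $c\ge 0$ (independent of $k$), $(y^k)^{T}s^k\le \mu^k c$; 4. for some $0<\ell\le u$ (independent of $k$), $\mu^k\ell\le a_i(x^k)+s_i^k\le\mu^k u$ for all $i$ with $a_i(x^* )=0$; 5. for some $d\ge 0$ (independent of $k$), $\|\nabla_x\mathcal{L}(x^k,y^k)\|\le d\mu^k(\|y^k\|_1+1)$; 6. $x^*$ is a KKT point with Lagrange multiplier $y^*$; 7. there exist $\theta\ge 0$ and a neighborhood $\mathcal{B}$ of $x^*$ such that the functions $\hat{\mathcal{L}}_k(x):=\mathcal{L}(x,y^k)+\theta\, a(x)^{T}Y^k a(x)$, for all $k$, and $\hat{\mathcal{L}}_*(x):=\mathcal{L}(x,y^* )+\theta\, a(x)^{T}Y^* a(x)$ are star-convex around $x^*$ on $\mathcal{B}$, where $Y^k=\mathrm{diag}(y^k)$ and $Y^*=\mathrm{diag}(y^* )$. Then $\{y^k\}$ is bounded.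
   Context: The functions $f:\mathbb{R}^n\to\mathbb{R}$ and $a=(a_1,\dots,a_m):\mathbb{R}^n\to\mathbb{R}^m$ are continuously differentiable (not necessarily convex). The problem under consideration is: minimize $f(x)$ subject to $a(x)+s=0$, $s\ge 0$ (equivalently, minimize $f(x)$ subject to $a(x)\le 0$). Vector inequalities are componentwise. The Lagrangian is $\mathcal{L}(x,y):=f(x)+y^{T}a(x)$. A Lagrange multiplier associated with a feasible point $x^*$ is a vector $y^*\in\mathbb{R}^m$ with $\nabla_x\mathcal{L}(x^*,y^* )=0$, $y^*\ge 0$ and $a(x^* )^{T}y^*=0$; $x^*$ is a KKT point if such a multiplier exists. A function $q:\mathbb{R}^n\to\mathbb{R}$ is star-convex around $x^*$ on a set $S\subseteq\mathbb{R}^n$ if $q(\alpha x+(1-\alpha)x^* )\le\alpha q(x)+(1-\alpha)q(x^* )$ for all $\alpha\in[0,1]$ and $x\in S$. $\|\cdot\|$ is the Euclidean norm, $\|\cdot\|_1$ the $\ell_1$-norm. Conditions on sequence elements stated without an explicit quantifier over $k$ are meant for all sufficiently large $k$. *)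

theory Defs
  imports "HOL-Analysis.Analysis"
begin

definition continuously_differentiable ::
    "('a::real_normed_vector \<Rightarrow> 'b::real_normed_vector) \<Rightarrow> bool" where
  "continuously_differentiable f \<longleftrightarrow>
     (\<exists>f' :: 'a \<Rightarrow> 'a \<Rightarrow>\<^sub>L 'b.
        (\<forall>x. (f has_derivative blinfun_apply (f' x)) (at x)) \<and> continuous_on UNIV f')"

(* Only meaningful where the function is differentiable, in which case D is unique. *)
definition gradient :: "('a::real_inner \<Rightarrow> real) \<Rightarrow> 'a \<Rightarrow> 'a" where
  "gradient f x = (THE D. GDERIV f x :> D)"

definition l1_norm :: "real ^ 'm \<Rightarrow> real" where
  "l1_norm y = (\<Sum>i\<in>UNIV. \<bar>y $ i\<bar>)"

definition diag_matrix :: "real ^ 'm \<Rightarrow> real ^ 'm ^ 'm" where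
  "diag_matrix y = (\<chi> i j. if i = j then y $ i else 0)"

definition lagrangian ::
    "(real ^ 'n \<Rightarrow> real) \<Rightarrow> (real ^ 'n \<Rightarrow> real ^ 'm) \<Rightarrow> real ^ 'n \<Rightarrow> real ^ 'm \<Rightarrow> real" where
  "lagrangian f a x y = f x + y \<bullet> a x"

definition augmented_lagrangian ::
    "(real ^ 'n \<Rightarrow> real) \<Rightarrow> (real ^ 'n \<Rightarrow> real ^ 'm) \<Rightarrow> real \<Rightarrow> real ^ 'n \<Rightarrow> real ^ 'm \<Rightarrow> real" where
  "augmented_lagrangian f a \<theta> x y =
     lagrangian f a x y + \<theta> * (a x \<bullet> (diag_matrix y *v a x))"

(* The order on real vectors is the componentwise one. *)
definition lagrange_multiplier ::
    "(real ^ 'n \<Rightarrow> real) \<Rightarrow> (real ^ 'n \<Rightarrow> real ^ 'm) \<Rightarrow> real ^ 'n \<Rightarrow> real ^ 'm \<Rightarrow> bool" where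
  "lagrange_multiplier f a x y \<longleftrightarrow>
     a x \<le> 0 \<and> gradient (\<lambda>z. lagrangian f a z y) x = 0 \<and> 0 \<le> y \<and> a x \<bullet> y = 0"

definition kkt_point ::
    "(real ^ 'n \<Rightarrow> real) \<Rightarrow> (real ^ 'n \<Rightarrow> real ^ 'm) \<Rightarrow> real ^ 'n \<Rightarrow> bool" where
  "kkt_point f a x \<longleftrightarrow> (\<exists>y. lagrange_multiplier f a x y)"

definition star_convex_around ::
    "('a::real_vector \<Rightarrow> real) \<Rightarrow> 'a \<Rightarrow> 'a set \<Rightarrow> bool" where
  "star_convex_around q c S \<longleftrightarrow>
     (\<forall>\<alpha>\<in>{0..1}. \<forall>x\<in>S. q (\<alpha> *\<^sub>R x + (1 - \<alpha>) *\<^sub>R c) \<le> \<alpha> * q x + (1 - \<alpha>) * q c)"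

end

theory Submission
  imports Defs
begin

text \<open>Star-convexity of the augmented Lagrangian at \<open>ys\<close>, whose gradient vanishes at \<open>xs\<close>, gives
  \<open>f (x k) \<ge> f xs - O(\<mu> k)\<close>. Star-convexity at \<open>y k\<close>, linearised at \<open>x k\<close>, bounds
  \<open>y k \<bullet> a (x k)\<close> from above by \<open>O(\<mu> k) + o(\<mu> k) * l1_norm (y k)\<close>, while the conditions on the
  slacks bound it from below by \<open>\<mu> k * l * l1_norm (y k) - O(\<mu> k)\<close>. Dividing by \<open>\<mu> k\<close> bounds
  \<open>l1_norm (y k)\<close>.\<close>

section \<open>First-order consequences of star-convexity\<close>

text \<open>A slope above \<open>K\<close> would make \<open>q (z + t *\<^sub>R v) - t * K\<close>
  increase strictly just to the right of 0, against \<open>bound\<close>. Star-convexity along a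
  segment supplies such a one-sided bound at either endpoint.\<close>

lemma has_derivative_le_of_linear_bound:
  fixes q :: "'a::real_normed_vector \<Rightarrow> real"
  assumes D: "(q has_derivative D) (at z)"
    and bound: "\<And>t. 0 \<le> t \<Longrightarrow> t \<le> 1 \<Longrightarrow> q (z + t *\<^sub>R v) \<le> q z + t * K"
  shows "D v \<le> K"
proof (rule ccontr)
  assume "\<not> D v \<le> K"
  let ?h = "\<lambda>t::real. q (z + t *\<^sub>R v) - t * K"
  interpret D: bounded_linear D
    using D by (rule has_derivative_bounded_linear)
  have "((\<lambda>t. z + t *\<^sub>R v) has_derivative (\<lambda>t. t *\<^sub>R v)) (at 0)"
    by (auto intro!: derivative_eq_intros)
  moreover have "(q has_derivative D) (at (z + 0 *\<^sub>R v))"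
    using D by simp
  ultimately have "((\<lambda>t. q (z + t *\<^sub>R v)) has_derivative (\<lambda>t. D (t *\<^sub>R v))) (at 0)"
    by (rule has_derivative_compose)
  then have "((\<lambda>t. q (z + t *\<^sub>R v)) has_real_derivative D v) (at 0)"
    by (simp add: has_field_derivative_def D.scaleR mult_commute_abs)
  then have "(?h has_real_derivative (D v - K)) (at 0)"
    by (auto intro!: derivative_eq_intros)
  with \<open>\<not> D v \<le> K\<close> obtain d where d: "d > 0" "\<And>t. 0 < t \<Longrightarrow> t < d \<Longrightarrow> ?h 0 < ?h (0 + t)"
    using DERIV_pos_inc_right[of ?h "D v - K" 0] by auto
  \<comment> \<open>This point lies both in \<open>(0, d)\<close>, where the increase holds, and in
    \<open>[0, 1]\<close>, where \<open>bound\<close> applies.\<close>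
  let ?t = "min 1 (d / 2)"
  have "?h 0 < ?h (0 + ?t)"
    using d(1) by (intro d(2)) auto
  moreover have "q (z + ?t *\<^sub>R v) \<le> q z + ?t * K"
    using d(1) by (intro bound) auto
  ultimately show False
    by simp
qed

text \<open>On the segment from \<open>c\<close> to \<open>z\<close>, star-convexity is a linear
  bound of slope \<open>q z - q c\<close>. When the derivative at the center vanishes, the center
  minimises \<open>q\<close> over \<open>S\<close>.\<close>

lemma star_convex_around_derivative_center:
  assumes "star_convex_around q c S" "z \<in> S" "(q has_derivative D) (at c)"
  shows "D (z - c) \<le> q z - q c"
proof (rule has_derivative_le_of_linear_bound[OF assms(3)])
  fix t :: real assume t: "0 \<le> t" "t \<le> 1"
  have "c + t *\<^sub>R (z - c) = t *\<^sub>R z + (1 - t) *\<^sub>R c"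
    by (simp add: algebra_simps)
  moreover have "q (t *\<^sub>R z + (1 - t) *\<^sub>R c) \<le> t * q z + (1 - t) * q c"
    using assms(1,2) t unfolding star_convex_around_def by auto
  ultimately show "q (c + t *\<^sub>R (z - c)) \<le> q c + t * (q z - q c)"
    by (simp add: algebra_simps)
qed

text \<open>The same segment is run backwards from \<open>z\<close>, with parameter
  \<open>1 - t\<close>. This is the gradient inequality of convex functions, restricted to the
  direction of the center.\<close>

lemma star_convex_around_derivative_point:
  assumes "star_convex_around q c S" "z \<in> S" "(q has_derivative D) (at z)"
  shows "D (c - z) \<le> q c - q z"
proof (rule has_derivative_le_of_linear_bound[OF assms(3)])
  fix t :: real assume t: "0 \<le> t" "t \<le> 1"
  have "z + t *\<^sub>R (c - z) = (1 - t) *\<^sub>R z + (1 - (1 - t)) *\<^sub>R c"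
    by (simp add: algebra_simps)
  moreover have "q ((1 - t) *\<^sub>R z + (1 - (1 - t)) *\<^sub>R c) \<le> (1 - t) * q z + (1 - (1 - t)) * q c"
    using assms(1)[unfolded star_convex_around_def, rule_format, of "1 - t" z] assms(2) t by simp
  ultimately show "q (z + t *\<^sub>R (c - z)) \<le> q z + t * (q c - q z)"
    by (simp add: algebra_simps)
qed

section \<open>Gradients and the augmented Lagrangian\<close>

lemma gradient_inner:
  fixes q :: "'a::euclidean_space \<Rightarrow> real"
  assumes "(q has_derivative D) (at z)"
  shows "gradient q z \<bullet> v = D v"
proof -
  interpret D: bounded_linear D
    using assms by (rule has_derivative_bounded_linear)
  \<comment> \<open>The Riesz representative of \<open>D\<close>. It witnesses existence for the
    definite description in \<open>gradient\<close>; uniqueness of derivatives does the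
    rest.\<close>
  let ?g = "\<Sum>b\<in>Basis. D b *\<^sub>R b"
  have D_eq: "D w = w \<bullet> ?g" for w
  proof -
    have "D w = D (\<Sum>b\<in>Basis. (w \<bullet> b) *\<^sub>R b)"
      by (simp only: euclidean_representation)
    also have "\<dots> = (\<Sum>b\<in>Basis. (w \<bullet> b) * D b)"
      by (simp only: D.sum D.scaleR real_scaleR_def)
    also have "\<dots> = w \<bullet> ?g"
      by (simp add: inner_sum_right mult.commute)
    finally show ?thesis .
  qed
  have "GDERIV q z :> ?g"
    unfolding gderiv_def using assms by (simp only: D_eq[symmetric])
  then have "gradient q z = ?g"
    unfolding gradient_def
  proof (rule the_equality)
    fix g assume "GDERIV q z :> g"
    then have "(\<lambda>h. h \<bullet> g) = (\<lambda>h. h \<bullet> ?g)"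
      using \<open>GDERIV q z :> ?g\<close> unfolding gderiv_def by (rule has_derivative_unique)
    then show "g = ?g"
      by (metis vector_eq_ldot)
  qed
  then show ?thesis
    using D_eq[of v] by (simp add: inner_commute)
qed

lemma augmented_lagrangian_eq_sum:
  "augmented_lagrangian f a \<theta> z y =
     f z + (\<Sum>i\<in>UNIV. y $ i * a z $ i) + \<theta> * (\<Sum>i\<in>UNIV. y $ i * (a z $ i)\<^sup>2)"
proof -
  have "(diag_matrix y *v w) $ i = y $ i * w $ i" for w i
    by (simp add: matrix_vector_mult_def diag_matrix_def if_distrib[of "\<lambda>t. t * _"] cong: if_cong)
  then show ?thesis
    by (simp add: augmented_lagrangian_def lagrangian_def inner_vec_def power2_eq_square mult_ac)
qed

lemma has_derivative_lagrangian:
  assumes "(f has_derivative F) (at z)" "(a has_derivative A) (at z)"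
  shows "((\<lambda>z. lagrangian f a z y) has_derivative (\<lambda>v. F v + y \<bullet> A v)) (at z)"
  unfolding lagrangian_def using assms by (auto intro!: derivative_eq_intros)

text \<open>The Lagrangian part is phrased through \<open>gradient\<close> so that stationarity of
  the multiplier \<open>ys\<close> and the norm bound for \<open>y k\<close> apply directly. Each
  penalty term keeps the factor \<open>y $ i * a z $ i\<close>, which complementarity makes zero or
  small.\<close>

lemma has_derivative_augmented_lagrangian:
  assumes "(f has_derivative F) (at z)" "(a has_derivative A) (at z)"
  shows "((\<lambda>z. augmented_lagrangian f a \<theta> z y) has_derivative
    (\<lambda>v. gradient (\<lambda>z. lagrangian f a z y) z \<bullet> v
       + 2 * \<theta> * (\<Sum>i\<in>UNIV. y $ i * a z $ i * A v $ i))) (at z)"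
proof -
  have eq: "augmented_lagrangian f a \<theta> w y = lagrangian f a w y + \<theta> * (\<Sum>i\<in>UNIV. y $ i * (a w $ i)\<^sup>2)"
    for w
    by (simp add: augmented_lagrangian_eq_sum lagrangian_def inner_vec_def)
  have comp: "((\<lambda>z. a z $ i) has_derivative (\<lambda>v. A v $ i)) (at z)" for i
    using assms(2) by (rule bounded_linear.has_derivative[OF bounded_linear_vec_nth])
  have "((\<lambda>z. \<theta> * (\<Sum>i\<in>UNIV. y $ i * (a z $ i)\<^sup>2)) has_derivative
      (\<lambda>v. \<theta> * (\<Sum>i\<in>UNIV. y $ i * (2 * (A v $ i * a z $ i))))) (at z)"
    by (auto intro!: derivative_eq_intros comp simp: mult.assoc)
  then have "((\<lambda>z. augmented_lagrangian f a \<theta> z y) has_derivative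
     (\<lambda>v. (F v + y \<bullet> A v) + \<theta> * (\<Sum>i\<in>UNIV. y $ i * (2 * (A v $ i * a z $ i))))) (at z)"
    unfolding eq using has_derivative_lagrangian[OF assms] by (intro has_derivative_add)
  then show ?thesis
    using gradient_inner[OF has_derivative_lagrangian[OF assms]]
    by (simp add: sum_distrib_left mult_ac)
qed

section \<open>Estimates for a single constraint\<close>

text \<open>For an active constraint \<open>\<alpha> k + \<sigma> k\<close> is of order
  \<open>\<mu> k\<close>; for an inactive one the slack stays away from 0, which forces
  \<open>\<eta> k\<close> to be of order \<open>\<mu> k\<close>. Here \<open>\<alpha>\<close>,
  \<open>\<sigma>\<close>, \<open>\<eta>\<close>, \<open>\<eta>0\<close> are components of
  \<open>a (x k)\<close>, \<open>s k\<close>, \<open>y k\<close>, \<open>ys\<close>. The four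
  estimates serve, in turn, the Lagrangian term at \<open>x k\<close>, the penalty derivative, the
  penalty at \<open>xs\<close>, and the terms weighted by \<open>ys\<close>.\<close>

lemma constraint_component_bounds:
  fixes \<eta> \<sigma> \<alpha> \<mu> :: "nat \<Rightarrow> real" and \<alpha>0 \<eta>0 c l u \<theta> :: real
  assumes \<mu>: "\<forall>\<^sub>F k in sequentially. \<mu> k > 0" "\<mu> \<longlonglongrightarrow> 0"
    and lim: "\<alpha> \<longlonglongrightarrow> \<alpha>0" "\<sigma> \<longlonglongrightarrow> - \<alpha>0"
    and slack: "\<forall>\<^sub>F k in sequentially. 0 \<le> \<eta> k \<and> 0 \<le> \<sigma> k \<and> \<eta> k * \<sigma> k \<le> \<mu> k * c"
    and active: "\<alpha>0 = 0 \<Longrightarrow> \<forall>\<^sub>F k in sequentially. \<mu> k * l \<le> \<alpha> k + \<sigma> k \<and> \<alpha> k + \<sigma> k \<le> \<mu> k * u"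
    and params: "0 \<le> c" "0 < l" "l \<le> u" "0 \<le> \<theta>"
    and mult: "\<alpha>0 \<le> 0" "0 \<le> \<eta>0" "\<alpha>0 * \<eta>0 = 0"
  shows "\<exists>C\<ge>0. \<forall>\<^sub>F k in sequentially.
    \<mu> k * l * \<eta> k - C * \<mu> k \<le> \<eta> k * \<alpha> k \<and> \<eta> k * \<bar>\<alpha> k\<bar> \<le> C * \<mu> k * (\<eta> k + 1) \<and>
    \<eta> k * \<alpha>0\<^sup>2 \<le> C * \<mu> k \<and> \<eta>0 * (\<alpha> k + \<theta> * (\<alpha> k)\<^sup>2) \<le> C * \<mu> k"
proof (cases "\<alpha>0 = 0")
  case True
  \<comment> \<open>Active case: \<open>c\<close> pays for \<open>\<eta> k * \<sigma> k\<close>,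
    \<open>u\<close> for the upper bound on \<open>\<eta> k * \<alpha> k\<close>, and
    \<open>2 * u * \<eta>0\<close> for the last estimate, whose 2 bounds
    \<open>1 + \<theta> * \<alpha> k\<close>.\<close>
  define C where "C = c + u + 2 * u * \<eta>0"
  have "(\<lambda>k. \<theta> * \<alpha> k) \<longlonglongrightarrow> \<theta> * 0"
    using lim(1) True by (intro tendsto_intros) simp
  then have "\<forall>\<^sub>F k in sequentially. \<bar>\<theta> * \<alpha> k\<bar> < 1"
    by (auto dest!: tendstoD[where e = 1])
  then have "\<forall>\<^sub>F k in sequentially.
    \<mu> k * l * \<eta> k - C * \<mu> k \<le> \<eta> k * \<alpha> k \<and> \<eta> k * \<bar>\<alpha> k\<bar> \<le> C * \<mu> k * (\<eta> k + 1) \<and>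
    \<eta> k * \<alpha>0\<^sup>2 \<le> C * \<mu> k \<and> \<eta>0 * (\<alpha> k + \<theta> * (\<alpha> k)\<^sup>2) \<le> C * \<mu> k"
    using \<mu>(1) slack active[OF True]
  proof eventually_elim
    case (elim k)
    note k = elim
    have nn: "0 \<le> \<mu> k * u" "0 \<le> \<mu> k * c" "0 \<le> \<mu> k * u * \<eta>0"
        "0 \<le> \<mu> k * u * \<eta> k" "0 \<le> \<mu> k * c * \<eta> k" "0 \<le> \<mu> k * u * \<eta>0 * \<eta> k"
      using k params mult by auto
    have "\<eta> k * (\<alpha> k + \<sigma> k) \<le> \<eta> k * (\<mu> k * u)" "\<eta> k * (\<mu> k * l) \<le> \<eta> k * (\<alpha> k + \<sigma> k)"
      using k by (auto intro: mult_left_mono)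
    then have up: "\<eta> k * \<alpha> k + \<eta> k * \<sigma> k \<le> \<mu> k * u * \<eta> k"
      and lo: "\<mu> k * l * \<eta> k \<le> \<eta> k * \<alpha> k + \<eta> k * \<sigma> k"
      by (simp_all add: algebra_simps)
    have "0 \<le> \<mu> k * l * \<eta> k" "0 \<le> \<eta> k * \<sigma> k"
      using k params by auto
    have 1: "\<mu> k * l * \<eta> k - C * \<mu> k \<le> \<eta> k * \<alpha> k"
      using lo k nn unfolding C_def by (simp add: algebra_simps)
    have "\<eta> k * \<bar>\<alpha> k\<bar> = \<bar>\<eta> k * \<alpha> k\<bar>"
      using k by (simp add: abs_mult)
    also have "\<dots> \<le> \<mu> k * u * \<eta> k + \<mu> k * c"
      using up lo k nn \<open>0 \<le> \<mu> k * l * \<eta> k\<close> \<open>0 \<le> \<eta> k * \<sigma> k\<close> by linarith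
    also have "\<dots> \<le> C * \<mu> k * (\<eta> k + 1)"
      using nn unfolding C_def by (simp add: algebra_simps)
    finally have 2: "\<eta> k * \<bar>\<alpha> k\<bar> \<le> C * \<mu> k * (\<eta> k + 1)" .
    have 3: "\<eta> k * \<alpha>0\<^sup>2 \<le> C * \<mu> k"
      using True nn unfolding C_def by (simp add: algebra_simps)
    \<comment> \<open>Since \<open>\<alpha> k\<close> may be negative, its square is not bounded
      directly: the factor \<open>1 + \<theta> * \<alpha> k\<close> lies between 0 and 2, so the
      upper bound \<open>\<mu> k * u\<close> on \<open>\<alpha> k\<close> suffices.\<close>
    have "\<alpha> k + \<theta> * (\<alpha> k)\<^sup>2 = \<alpha> k * (1 + \<theta> * \<alpha> k)"
      by (simp add: algebra_simps power2_eq_square)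
    also have "\<dots> \<le> \<mu> k * u * (1 + \<theta> * \<alpha> k)"
      using k by (intro mult_right_mono) auto
    also have "\<dots> \<le> \<mu> k * u * 2"
      using k nn by (intro mult_left_mono) auto
    finally have "\<eta>0 * (\<alpha> k + \<theta> * (\<alpha> k)\<^sup>2) \<le> \<eta>0 * (\<mu> k * u * 2)"
      using mult by (intro mult_left_mono)
    also have "\<dots> \<le> C * \<mu> k"
      using nn unfolding C_def by (simp add: algebra_simps)
    finally show ?case
      using 1 2 3 by blast
  qed
  moreover have "0 \<le> C"
    using params mult unfolding C_def by auto
  ultimately show ?thesis
    by blast
next
  case False
  with mult have neg: "\<alpha>0 < 0" and "\<eta>0 = 0"
    by auto
  \<comment> \<open>Inactive case: eventually \<open>\<sigma> k > - \<alpha>0 / 2\<close>, so the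
    bound on \<open>\<eta> k * \<sigma> k\<close> gives \<open>\<eta> k \<le> K * \<mu> k\<close>.
    The summands of \<open>C\<close> then cover the first three estimates, using
    \<open>\<mu> k < 1\<close> and
    \<open>\<bar>\<alpha> k\<bar> < 2 * \<bar>\<alpha>0\<bar>\<close>; the fourth is trivial because
    \<open>\<eta>0 = 0\<close>.\<close>
  define K where "K = 2 * c / (- \<alpha>0)"
  define C where "C = K * (l + 2 * \<bar>\<alpha>0\<bar> + \<alpha>0\<^sup>2)"
  have K: "0 \<le> K"
    using neg params unfolding K_def by (intro divide_nonneg_nonneg) auto
  have s: "\<forall>\<^sub>F k in sequentially. \<sigma> k > - \<alpha>0 / 2"
    using neg by (intro order_tendstoD(1)[OF lim(2)]) auto
  have a: "\<forall>\<^sub>F k in sequentially. \<alpha> k > 2 * \<alpha>0" "\<forall>\<^sub>F k in sequentially. \<alpha> k < 0"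
    using neg by (auto intro!: order_tendstoD[OF lim(1)])
  have m: "\<forall>\<^sub>F k in sequentially. \<mu> k < 1"
    by (rule order_tendstoD(2)[OF \<mu>(2)]) simp
  have "\<forall>\<^sub>F k in sequentially.
    \<mu> k * l * \<eta> k - C * \<mu> k \<le> \<eta> k * \<alpha> k \<and> \<eta> k * \<bar>\<alpha> k\<bar> \<le> C * \<mu> k * (\<eta> k + 1) \<and>
    \<eta> k * \<alpha>0\<^sup>2 \<le> C * \<mu> k \<and> \<eta>0 * (\<alpha> k + \<theta> * (\<alpha> k)\<^sup>2) \<le> C * \<mu> k"
    using \<mu>(1) slack s a m
  proof eventually_elim
    case (elim k)
    note k = elim
    have "\<eta> k * (- \<alpha>0 / 2) \<le> \<eta> k * \<sigma> k"
      using k by (intro mult_left_mono) auto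
    also have "\<dots> \<le> \<mu> k * c"
      using k by auto
    finally have \<eta>: "\<eta> k \<le> K * \<mu> k"
      using neg unfolding K_def by (simp add: field_simps)
    have nn: "0 \<le> K * \<mu> k * l" "0 \<le> K * \<mu> k * \<bar>\<alpha>0\<bar>" "0 \<le> K * \<mu> k * \<alpha>0\<^sup>2" "0 \<le> C * \<mu> k"
      using K k params unfolding C_def by (intro mult_nonneg_nonneg add_nonneg_nonneg; simp)+
    have "\<eta> k * \<bar>\<alpha> k\<bar> \<le> K * \<mu> k * (2 * \<bar>\<alpha>0\<bar>)"
      using k \<eta> K neg by (intro mult_mono) auto
    moreover have "\<mu> k * l * \<eta> k \<le> 1 * l * (K * \<mu> k)"
      using k \<eta> K params by (intro mult_mono) auto
    moreover have "\<eta> k * \<alpha>0\<^sup>2 \<le> K * \<mu> k * \<alpha>0\<^sup>2"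
      using \<eta> by (intro mult_right_mono) auto
    moreover have "C * \<mu> k = K * \<mu> k * l + K * \<mu> k * (2 * \<bar>\<alpha>0\<bar>) + K * \<mu> k * \<alpha>0\<^sup>2"
      unfolding C_def by (simp add: algebra_simps)
    moreover have "C * \<mu> k * (\<eta> k + 1) = C * \<mu> k * \<eta> k + C * \<mu> k"
      by (simp add: algebra_simps)
    moreover have "0 \<le> C * \<mu> k * \<eta> k"
      using mult_nonneg_nonneg[OF nn(4)] k by blast
    moreover have "\<eta> k * \<bar>\<alpha> k\<bar> = - (\<eta> k * \<alpha> k)"
      using k by simp
    ultimately show ?case
      using nn \<open>\<eta>0 = 0\<close> by (simp add: mult.commute[of _ l])
  qed
  moreover have "0 \<le> C"
    using K params unfolding C_def by auto
  ultimately show ?thesis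
    by blast
qed

section \<open>Boundedness of the multiplier sequence\<close>

theorem theorem2:
  fixes f :: "real ^ 'n \<Rightarrow> real"
    and a :: "real ^ 'n \<Rightarrow> real ^ 'm"
    and x :: "nat \<Rightarrow> real ^ 'n"
    and y s :: "nat \<Rightarrow> real ^ 'm"
    and \<mu> :: "nat \<Rightarrow> real"
    and xs :: "real ^ 'n"
    and ys :: "real ^ 'm"
  assumes "continuously_differentiable f"
    and "continuously_differentiable a"
    and "\<forall>\<^sub>F k in sequentially. \<mu> k > 0"
    and "\<mu> \<longlonglongrightarrow> 0"
    and "x \<longlonglongrightarrow> xs"
    and "a xs \<le> 0"
    and "s \<longlonglongrightarrow> - a xs"
    and "\<forall>\<^sub>F k in sequentially. 0 \<le> y k \<and> 0 \<le> s k"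
    and "\<exists>c\<ge>0. \<forall>\<^sub>F k in sequentially. y k \<bullet> s k \<le> \<mu> k * c"
    and "\<exists>l u. 0 < l \<and> l \<le> u \<and>
           (\<forall>\<^sub>F k in sequentially. \<forall>i. a xs $ i = 0 \<longrightarrow>
              \<mu> k * l \<le> a (x k) $ i + s k $ i \<and> a (x k) $ i + s k $ i \<le> \<mu> k * u)"
    and "\<exists>d\<ge>0. \<forall>\<^sub>F k in sequentially.
           norm (gradient (\<lambda>z. lagrangian f a z (y k)) (x k)) \<le> d * \<mu> k * (l1_norm (y k) + 1)"
    and "kkt_point f a xs" and "lagrange_multiplier f a xs ys"
    and "\<exists>\<theta>\<ge>0. \<exists>B. xs \<in> interior B \<and>
           (\<forall>k. star_convex_around (\<lambda>z. augmented_lagrangian f a \<theta> z (y k)) xs B) \<and>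
           star_convex_around (\<lambda>z. augmented_lagrangian f a \<theta> z ys) xs B"
  shows "bounded (range y)"
proof -
  obtain F where F: "\<And>z. (f has_derivative blinfun_apply (F z)) (at z)"
    using assms(1) unfolding continuously_differentiable_def by blast
  obtain A where A: "\<And>z. (a has_derivative blinfun_apply (A z)) (at z)" "continuous_on UNIV A"
    using assms(2) unfolding continuously_differentiable_def by blast
  obtain c where c: "c \<ge> 0" "\<forall>\<^sub>F k in sequentially. y k \<bullet> s k \<le> \<mu> k * c"
    using assms(9) by blast
  obtain l u where lu: "0 < l" "l \<le> u"
    "\<forall>\<^sub>F k in sequentially. \<forall>i. a xs $ i = 0 \<longrightarrow>
      \<mu> k * l \<le> a (x k) $ i + s k $ i \<and> a (x k) $ i + s k $ i \<le> \<mu> k * u"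
    using assms(10) by blast
  obtain d where d: "d \<ge> 0" "\<forall>\<^sub>F k in sequentially.
      norm (gradient (\<lambda>z. lagrangian f a z (y k)) (x k)) \<le> d * \<mu> k * (l1_norm (y k) + 1)"
    using assms(11) by blast
  obtain \<theta> B where \<theta>: "\<theta> \<ge> 0" and B: "xs \<in> interior B"
    and star: "\<And>k. star_convex_around (\<lambda>z. augmented_lagrangian f a \<theta> z (y k)) xs B"
    and star_ys: "star_convex_around (\<lambda>z. augmented_lagrangian f a \<theta> z ys) xs B"
    using assms(14) by blast
  have grad_ys: "gradient (\<lambda>z. lagrangian f a z ys) xs = 0"
    and ys: "0 \<le> ys $ i" and feas: "a xs $ i \<le> 0" for i
    using assms(13) by (auto simp: lagrange_multiplier_def less_eq_vec_def)
  have compl: "ys $ i * a xs $ i = 0" for i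
  proof -
    \<comment> \<open>Negation makes all summands nonnegative, so the vanishing sum forces each one
      to vanish.\<close>
    have "(\<Sum>i\<in>UNIV. - (a xs $ i * ys $ i)) = 0"
      using assms(13) by (simp add: lagrange_multiplier_def inner_vec_def sum_negf)
    then have "\<forall>i\<in>UNIV. - (a xs $ i * ys $ i) = 0"
      using ys feas by (subst (asm) sum_nonneg_eq_0_iff) (auto intro: mult_nonpos_nonneg)
    then show ?thesis
      by (simp add: mult.commute)
  qed

  have a_lim: "(\<lambda>k. a (x k)) \<longlonglongrightarrow> a xs"
    using has_derivative_continuous[OF A(1)] assms(5) by (rule isCont_tendsto_compose)
  have ys_nonneg: "\<forall>\<^sub>F k in sequentially. \<forall>i. 0 \<le> y k $ i \<and> 0 \<le> s k $ i"
    using assms(8) by eventually_elim (auto simp: less_eq_vec_def)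
  define P where "P i C k \<longleftrightarrow>
      \<mu> k * l * y k $ i - C * \<mu> k \<le> y k $ i * a (x k) $ i \<and>
      y k $ i * \<bar>a (x k) $ i\<bar> \<le> C * \<mu> k * (y k $ i + 1) \<and>
      y k $ i * (a xs $ i)\<^sup>2 \<le> C * \<mu> k \<and>
      ys $ i * (a (x k) $ i + \<theta> * (a (x k) $ i)\<^sup>2) \<le> C * \<mu> k" for i C k
  have "\<exists>C\<ge>0. \<forall>\<^sub>F k in sequentially. P i C k" for i
    unfolding P_def
  proof (rule constraint_component_bounds[where \<sigma> = "\<lambda>k. s k $ i" and c = c and u = u])
    show "(\<lambda>k. s k $ i) \<longlonglongrightarrow> - a xs $ i"
      using tendsto_vec_nth[OF assms(7), of i] by simp
    show "\<forall>\<^sub>F k in sequentially. 0 \<le> y k $ i \<and> 0 \<le> s k $ i \<and> y k $ i * s k $ i \<le> \<mu> k * c"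
      using ys_nonneg c(2)
    proof eventually_elim
      case (elim k)
      have "y k $ i * s k $ i \<le> (\<Sum>j\<in>UNIV. y k $ j * s k $ j)"
        using elim by (intro member_le_sum) auto
      then show ?case
        using elim by (simp add: inner_vec_def)
    qed
    show "\<forall>\<^sub>F k in sequentially. \<mu> k * l \<le> a (x k) $ i + s k $ i \<and> a (x k) $ i + s k $ i \<le> \<mu> k * u"
      if "a xs $ i = 0"
      using lu(3) by eventually_elim (use that in auto)
  qed (use assms(3,4) a_lim c lu \<theta> feas ys compl in \<open>auto intro: tendsto_vec_nth simp: mult.commute\<close>)
  then obtain C where C: "\<And>i. 0 \<le> C i" "\<And>i. \<forall>\<^sub>F k in sequentially. P i (C i) k"
    by metis
  \<comment> \<open>\<open>T\<close> serves both as a common bound for the constants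
    \<open>C i\<close> and as the total error after summing over the constraints.\<close>
  define T where "T = sum C UNIV"
  have T: "0 \<le> T" "C i \<le> T" for i
    using C(1) unfolding T_def by (auto intro: sum_nonneg member_le_sum)
  have "\<forall>\<^sub>F k in sequentially. \<forall>i. P i (C i) k"
    using C(2) by (rule eventually_all_finite)
  note C' = this[unfolded P_def]

  define M where "M = norm (A xs) + 1"
  have "(\<lambda>k. A (x k)) \<longlonglongrightarrow> A xs"
    using A(2) assms(5) by (auto simp: continuous_on_eq_continuous_at intro: isCont_tendsto_compose)
  then have A_bound: "\<forall>\<^sub>F k in sequentially. norm (A (x k)) < M"
    unfolding M_def by (intro order_tendstoD(2)[OF tendsto_norm]) auto
  define m where "m = real CARD('m)"
  have m: "1 \<le> m"
    unfolding m_def by (simp add: Suc_le_eq)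
  \<comment> \<open>Coefficient of \<open>\<mu> k * (S + m) * norm (x k - xs)\<close> in the
    linearisation error: \<open>d\<close> from the gradient of the Lagrangian, the rest from the
    penalty derivative.\<close>
  define E where "E = d + 2 * \<theta> * T * M"
  have "(\<lambda>k. E * norm (x k - xs)) \<longlonglongrightarrow> E * norm (xs - xs)"
    using assms(5) by (intro tendsto_intros)
  \<comment> \<open>With threshold \<open>l / 2\<close> the error consumes at most half of
    \<open>l * S\<close>, so the other half still controls \<open>S\<close>.\<close>
  then have x_close: "\<forall>\<^sub>F k in sequentially. E * norm (x k - xs) < l / 2"
    using lu by (intro order_tendstoD(2)) auto
  have x_in: "\<forall>\<^sub>F k in sequentially. x k \<in> B"
    using topological_tendstoD[OF assms(5) open_interior B]
    by (rule eventually_mono) (use interior_subset in blast)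

  have "\<forall>\<^sub>F k in sequentially. norm (y k) \<le> 2 * (T * (2 + \<theta>) + l / 2 * m) / l"
    using assms(3) ys_nonneg d(2) C' A_bound x_close x_in
  proof eventually_elim
    case (elim k)
    note k = elim
    define S where "S = (\<Sum>i\<in>UNIV. y k $ i)"
    have S: "0 \<le> S" "l1_norm (y k) = S"
      using k unfolding S_def l1_norm_def by (auto intro: sum_nonneg)
    let ?\<delta> = "norm (x k - xs)"
    \<comment> \<open>Stationarity of \<open>ys\<close> removes the gradient term at
      \<open>xs\<close>, and \<open>compl\<close> removes the penalty derivative.\<close>
    have "0 \<le> augmented_lagrangian f a \<theta> (x k) ys - augmented_lagrangian f a \<theta> xs ys"
      using star_convex_around_derivative_center
          [OF star_ys k(7) has_derivative_augmented_lagrangian[OF F A(1)]]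
      by (simp add: compl grad_ys)
    moreover have "augmented_lagrangian f a \<theta> xs ys = f xs"
      by (simp add: augmented_lagrangian_eq_sum power2_eq_square mult.assoc[symmetric] compl)
    moreover have "augmented_lagrangian f a \<theta> (x k) ys =
        f (x k) + (\<Sum>i\<in>UNIV. ys $ i * (a (x k) $ i + \<theta> * (a (x k) $ i)\<^sup>2))"
      by (simp add: augmented_lagrangian_eq_sum sum_distrib_left sum.distrib algebra_simps)
    moreover have "(\<Sum>i\<in>UNIV. ys $ i * (a (x k) $ i + \<theta> * (a (x k) $ i)\<^sup>2)) \<le> T * \<mu> k"
      unfolding T_def sum_distrib_right using k by (intro sum_mono) auto
    ultimately have f_lower: "f xs - f (x k) \<le> T * \<mu> k"
      by linarith

    have "(\<Sum>i\<in>UNIV. y k $ i * (a xs $ i)\<^sup>2) \<le> T * \<mu> k"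
      unfolding T_def sum_distrib_right using k by (intro sum_mono) auto
    then have "\<theta> * (\<Sum>i\<in>UNIV. y k $ i * (a xs $ i)\<^sup>2) \<le> \<theta> * (T * \<mu> k)"
      using \<theta> by (intro mult_left_mono)
    moreover have "(\<Sum>i\<in>UNIV. y k $ i * a xs $ i) \<le> 0"
      using k feas by (intro sum_nonpos) (auto intro: mult_nonneg_nonpos)
    ultimately have at_xs: "augmented_lagrangian f a \<theta> xs (y k) \<le> f xs + \<theta> * (T * \<mu> k)"
      by (simp add: augmented_lagrangian_eq_sum)

    \<comment> \<open>This lower bound is the source of the result: it grows like
      \<open>\<mu> k * l * S\<close>, while the competing terms are \<open>O(\<mu> k)\<close> or
      carry a vanishing factor in front of \<open>S\<close>.\<close>
    have "\<mu> k * l * S - T * \<mu> k = (\<Sum>i\<in>UNIV. \<mu> k * l * y k $ i - C i * \<mu> k)"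
      unfolding T_def S_def by (simp add: sum_subtractf sum_distrib_left sum_distrib_right)
    also have "\<dots> \<le> (\<Sum>i\<in>UNIV. y k $ i * a (x k) $ i)"
      using k by (intro sum_mono) auto
    finally have "\<mu> k * l * S - T * \<mu> k \<le> (\<Sum>i\<in>UNIV. y k $ i * a (x k) $ i)" .
    moreover have "0 \<le> \<theta> * (\<Sum>i\<in>UNIV. y k $ i * (a (x k) $ i)\<^sup>2)"
      using \<theta> k by (intro mult_nonneg_nonneg sum_nonneg) auto
    ultimately have at_xk: "f (x k) + \<mu> k * l * S - T * \<mu> k \<le> augmented_lagrangian f a \<theta> (x k) (y k)"
      by (simp add: augmented_lagrangian_eq_sum)

    let ?g = "gradient (\<lambda>z. lagrangian f a z (y k)) (x k)"
    let ?w = "A (x k) (xs - x k)"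
    have "\<bar>?g \<bullet> (xs - x k)\<bar> \<le> norm ?g * ?\<delta>"
      using Cauchy_Schwarz_ineq2[of ?g "xs - x k"] by (simp add: norm_minus_commute)
    also have "\<dots> \<le> d * \<mu> k * (S + 1) * ?\<delta>"
      using k S by (intro mult_right_mono) auto
    \<comment> \<open>The 1 is enlarged to \<open>m\<close> to match the penalty error, where
      summing \<open>y k $ i + 1\<close> over all constraints yields \<open>S + m\<close>.\<close>
    also have "\<dots> \<le> d * \<mu> k * (S + m) * ?\<delta>"
      using k d m by (intro mult_right_mono mult_left_mono) auto
    finally have g: "\<bar>?g \<bullet> (xs - x k)\<bar> \<le> d * \<mu> k * (S + m) * ?\<delta>" .
    have w: "\<bar>?w $ i\<bar> \<le> M * ?\<delta>" for i
    proof -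
      have "\<bar>?w $ i\<bar> \<le> norm ?w"
        by (rule component_le_norm_cart)
      also have "\<dots> \<le> norm (A (x k)) * norm (xs - x k)"
        by (rule norm_blinfun)
      also have "\<dots> \<le> M * ?\<delta>"
        using k by (auto simp: norm_minus_commute intro: mult_right_mono)
      finally show ?thesis .
    qed
    have "\<bar>\<Sum>i\<in>UNIV. y k $ i * a (x k) $ i * ?w $ i\<bar> \<le> (\<Sum>i\<in>UNIV. T * \<mu> k * (y k $ i + 1) * (M * ?\<delta>))"
    proof (rule order_trans[OF sum_abs], rule sum_mono)
      fix i
      have "\<bar>y k $ i * a (x k) $ i * ?w $ i\<bar> = (y k $ i * \<bar>a (x k) $ i\<bar>) * \<bar>?w $ i\<bar>"
        using k by (simp add: abs_mult)
      also have "\<dots> \<le> (C i * \<mu> k * (y k $ i + 1)) * (M * ?\<delta>)"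
        using k(1) k(2)[rule_format, of i] k(4) w[of i] C(1)[of i] by (intro mult_mono[of "y k $ i * _"]) auto
      also have "\<dots> \<le> T * \<mu> k * (y k $ i + 1) * (M * ?\<delta>)"
        using k(1) k(2)[rule_format, of i] T by (intro mult_right_mono) (auto simp: M_def)
      finally show "\<bar>y k $ i * a (x k) $ i * ?w $ i\<bar> \<le> T * \<mu> k * (y k $ i + 1) * (M * ?\<delta>)" .
    qed
    also have "\<dots> = T * \<mu> k * (S + m) * (M * ?\<delta>)"
      unfolding S_def m_def
      by (simp add: sum_distrib_left[symmetric] sum_distrib_right[symmetric] sum.distrib)
    finally have "2 * \<theta> * \<bar>\<Sum>i\<in>UNIV. y k $ i * a (x k) $ i * ?w $ i\<bar>
        \<le> 2 * \<theta> * (T * \<mu> k * (S + m) * (M * ?\<delta>))"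
      using \<theta> by (intro mult_left_mono) auto
    then have q: "\<bar>2 * \<theta> * (\<Sum>i\<in>UNIV. y k $ i * a (x k) $ i * ?w $ i)\<bar>
        \<le> 2 * \<theta> * (T * \<mu> k * (S + m) * (M * ?\<delta>))"
      using \<theta> by (simp add: abs_mult)
    have "?g \<bullet> (xs - x k) + 2 * \<theta> * (\<Sum>i\<in>UNIV. y k $ i * a (x k) $ i * ?w $ i)
        \<le> augmented_lagrangian f a \<theta> xs (y k) - augmented_lagrangian f a \<theta> (x k) (y k)"
      using star_convex_around_derivative_point
        [OF star k(7) has_derivative_augmented_lagrangian[OF F A(1)]] .
    \<comment> \<open>The three copies of \<open>T * \<mu> k\<close>, one of them weighted by
      \<open>\<theta>\<close>, come from \<open>f_lower\<close>, \<open>at_xs\<close> and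
      \<open>at_xk\<close>; the last two terms are the linearisation errors \<open>g\<close> and
      \<open>q\<close>.\<close>
    then have "\<mu> k * l * S \<le> T * \<mu> k + \<theta> * (T * \<mu> k) + T * \<mu> k
        + d * \<mu> k * (S + m) * ?\<delta> + 2 * \<theta> * (T * \<mu> k * (S + m) * (M * ?\<delta>))"
      using f_lower at_xs at_xk g q by linarith
    also have "\<dots> = \<mu> k * (T * (2 + \<theta>) + E * ?\<delta> * (S + m))"
      unfolding E_def by (simp add: algebra_simps)
    finally have "l * S \<le> T * (2 + \<theta>) + E * ?\<delta> * (S + m)"
      using k(1) by (simp add: mult.assoc)
    also have "\<dots> \<le> T * (2 + \<theta>) + l / 2 * (S + m)"
      using k S m by (intro add_left_mono mult_right_mono) auto
    finally have "S \<le> 2 * (T * (2 + \<theta>) + l / 2 * m) / l"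
      using lu by (simp add: field_simps)
    moreover have "norm (y k) \<le> S"
      using norm_le_l1_cart[of "y k"] S(2) unfolding l1_norm_def by simp
    ultimately show ?case
      by linarith
  qed
  \<comment> \<open>An eventual norm bound suffices, since the finitely many remaining terms cannot
    destroy boundedness.\<close>
  then have "Bseq y"
    by (rule BfunI)
  then show ?thesis
    by (simp add: Bseq_eq_bounded)
qed

end
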